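(* There is a universal constant $c>0$ such that for all integers $n,k\ge 1$ and every function $f\colon\{0,1\}^n\to\{0,1\}$, $$\mathsf{R}(f^k)\;\ge\; c\cdot k\cdot \mathsf{disc}(f).$$
   Context: Inner products are over $\mathbb{F}_2$: $\langle a,x\rangle=\sum_i a_ix_i \bmod 2$. A deterministic parity decision tree $T$ on $\{0,1\}^N$ is a rooted binary tree in which every internal node is labelled by a vector $a\in\{0,1\}^N$ (the query $\langle a,x\rangle$) and has two children, one for each outcome in $\{0,1\}$, and every leaf is labelled by an output value; $T(x)$ is the label of the leaf reached on input $x$. The depth of $T$ is the maximum number of queries on a root-to-leaf path. A randomised parity decision tree $\mathcal{T}$ is a probability distribution over deterministic ones. For $g\colon\{0,1\}^N\to\{0,1\}^m$, $\mathsf{R}(g)$ is the least $d$ such that some randomised parity decision tree $\mathcal{T}$, supported on trees of depth at most $d$, satisfies $\Pr_{T\sim\mathcal{T}}[T(x)\ne g(x)]\le 1/3$ for every $x$. $f^k\colon(\{0,1\}^n)^k\to\{0,1\}^k$ is $f^k(x^1,\dots,x^k)=(f(x^1),\dots,f(x^k))$. Discrepancy: for a probability distribution $\mu$ on $\{0,1\}^n$ and an affine subspace $S\subseteq\{0,1\}^n=\mathbb{F}_2^n$, let $\mathsf{bias}(f,\mu,S)=\left|\sum_{x\in S}(-1)^{f(x)}\mu(x)\right|$. Let $\mathsf{disc}(f,\mu)=-\log_2\max_{S}\mathsf{bias}(f,\mu,S)$, the maximum over all affine subspaces $S$ of $\{0,1\}^n$, and $\mathsf{disc}(f)=\max_\mu\mathsf{disc}(f,\mu)$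 over all probability distributions $\mu$ on $\{0,1\}^n$. *)

theory Defs
  imports
    "Jordan_Normal_Form.VS_Connect"
    "HOL-Probability.Probability_Mass_Function"
    "HOL-Library.Z2"
begin

text \<open>
  The cube \<open>{0,1}\<^sup>N\<close> is \<open>carrier_vec N :: bit vec set\<close>, where \<open>bit\<close> is the two-element field, so that
  \<open>scalar_prod\<close> is the inner product modulo 2. Functions on a cube are total functions on
  \<open>bit vec\<close>; all definitions below only look at their values on the cube in question.
\<close>

type_synonym bitvec = "bit Matrix.vec"

datatype 'b pdt = Leaf 'b | Query bitvec "'b pdt" "'b pdt"

fun pdt_eval :: "'b pdt \<Rightarrow> bitvec \<Rightarrow> 'b" where
  "pdt_eval (Leaf b) x = b"
| "pdt_eval (Query a T0 T1) x = (if scalar_prod a x = 0 then pdt_eval T0 x else pdt_eval T1 x)"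

fun pdt_depth :: "'b pdt \<Rightarrow> nat" where
  "pdt_depth (Leaf b) = 0"
| "pdt_depth (Query a T0 T1) = Suc (max (pdt_depth T0) (pdt_depth T1))"

fun pdt_on :: "nat \<Rightarrow> 'b set \<Rightarrow> 'b pdt \<Rightarrow> bool" where
  "pdt_on N B (Leaf b) \<longleftrightarrow> b \<in> B"
| "pdt_on N B (Query a T0 T1) \<longleftrightarrow> a \<in> carrier_vec N \<and> pdt_on N B T0 \<and> pdt_on N B T1"

text \<open>
  There are only countably many trees with query vectors in \<open>{0,1}\<^sup>N\<close> and labels in \<open>{0,1}\<^sup>m\<close>, so
  every probability distribution on them is a \<open>pmf\<close>.
\<close>

definition rpdt_computes ::
    "nat \<Rightarrow> nat \<Rightarrow> (bitvec \<Rightarrow> bitvec) \<Rightarrow> nat \<Rightarrow> bitvec pdt pmf \<Rightarrow> bool" where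
  "rpdt_computes N m g d R \<longleftrightarrow>
     (\<forall>T \<in> set_pmf R. pdt_on N (carrier_vec m) T \<and> pdt_depth T \<le> d) \<and>
     (\<forall>x \<in> carrier_vec N. measure_pmf.prob R {T. pdt_eval T x \<noteq> g x} \<le> 1 / 3)"

text \<open>The minimum is over a nonempty set: depth \<open>N\<close> suffices to query every coordinate.\<close>

definition R_pdt :: "nat \<Rightarrow> nat \<Rightarrow> (bitvec \<Rightarrow> bitvec) \<Rightarrow> nat" where
  "R_pdt N m g = (LEAST d. \<exists>R. rpdt_computes N m g d R)"

text \<open>
  \<open>({0,1}\<^sup>n)\<^sup>k\<close> is identified with \<open>{0,1}\<^bsup>k n\<^esup>\<close> by concatenation: \<open>block n x j\<close> (with \<open>j < k\<close>) is the
  \<open>j\<close>-th block of length \<open>n\<close>, counted from 0.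
\<close>

definition block :: "nat \<Rightarrow> bitvec \<Rightarrow> nat \<Rightarrow> bitvec" where
  "block n x j = Matrix.vec n (\<lambda>i. vec_index x (j * n + i))"

definition direct_sum_fun :: "nat \<Rightarrow> nat \<Rightarrow> (bitvec \<Rightarrow> bit) \<Rightarrow> bitvec \<Rightarrow> bitvec" where
  "direct_sum_fun n k f x = Matrix.vec k (\<lambda>j. f (block n x j))"

definition affine_subspace :: "nat \<Rightarrow> bitvec set \<Rightarrow> bool" where
  "affine_subspace n S \<longleftrightarrow>
     (\<exists>v \<in> carrier_vec n. \<exists>W.
        VectorSpace.subspace class_ring W (module_vec TYPE(bit) n) \<and> S = (\<lambda>w. v + w) ` W)"

definition bias :: "(bitvec \<Rightarrow> bit) \<Rightarrow> bitvec pmf \<Rightarrow> bitvec set \<Rightarrow> real" where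
  "bias f \<mu> S = \<bar>\<Sum>x\<in>S. (if f x = 0 then 1 else - 1) * pmf \<mu> x\<bar>"

text \<open>
  There are finitely many affine subspaces, and the maximum is positive: a single point is an
  affine subspace, whose bias is its mass under \<open>\<mu>\<close>.
\<close>

definition disc_wrt :: "nat \<Rightarrow> (bitvec \<Rightarrow> bit) \<Rightarrow> bitvec pmf \<Rightarrow> real" where
  "disc_wrt n f \<mu> = - log 2 (Max {bias f \<mu> S |S. affine_subspace n S})"

text \<open>
  Some point has mass at least \<open>1 / 2\<^sup>n\<close> under \<open>\<mu>\<close>, so \<open>disc_wrt n f \<mu> \<le> n\<close> and the supremum is
  over a bounded set; it is a maximum, because \<open>disc_wrt n f\<close> is continuous on the compact simplex
  of distributions.
\<close>

definition disc :: "nat \<Rightarrow> (bitvec \<Rightarrow> bit) \<Rightarrow> real" where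
  "disc n f = (SUP \<mu> \<in> {\<mu>. set_pmf \<mu> \<subseteq> carrier_vec n}. disc_wrt n f \<mu>)"

end

theory Submission
  imports Defs
begin

text \<open>
  Fix \<open>\<mu>\<close> and write \<open>D\<close> for the discrepancy of \<open>f\<close> under \<open>\<mu>\<close>. Every Fourier coefficient of
  \<open>(-1)\<^sup>f \<mu>\<close> is a difference of two sums over parallel hyperplanes, hence at most \<open>2 \<cdot> 2\<^bsup>-D\<^esup>\<close>, and the
  Fourier coefficients of the \<open>k\<close>-fold product are products of such numbers. A tree of depth \<open>d\<close>
  computing \<open>f\<^sup>k\<close> also computes the parity of its \<open>k\<close> outputs, and its correlation with the product
  exceeds the largest Fourier coefficient by a factor of at most \<open>2\<^sup>d\<close>. So
  \<open>1/3 \<le> 2\<^sup>d (2 \<cdot> 2\<^bsup>-D\<^esup>)\<^sup>k\<close>, which settles \<open>D > 4\<close>. For smaller \<open>D\<close> it is enough that \<open>d \<ge> k\<close> for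
  nonconstant \<open>f\<close>: a tree of depth \<open>d\<close> has at most \<open>2\<^sup>d\<close> outputs, while \<open>f\<^sup>k\<close> takes all \<open>2\<^sup>k\<close> values.
\<close>

unbundle no inner_syntax
unbundle no vec_syntax

section \<open>The sign character of the two-element field, and finiteness of the cube\<close>

definition bsign :: "bit \<Rightarrow> real" where
  "bsign b = (if b = 0 then 1 else - 1)"

lemma bsign_zero [simp]: "bsign 0 = 1"
  and bsign_one [simp]: "bsign 1 = - 1"
  by (simp_all add: bsign_def)

lemma bsign_add: "bsign (a + b) = bsign a * bsign b"
  by (cases a; cases b) (simp_all add: bsign_def)

lemma bsign_mult_self [simp]: "bsign b * bsign b = 1"
  by (simp add: bsign_def)

lemma abs_bsign [simp]: "\<bar>bsign b\<bar> = 1"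
  by (simp add: bsign_def)

lemma bsign_sum: "bsign (\<Sum>i\<in>A. g i) = (\<Prod>i\<in>A. bsign (g i))"
  by (induction A rule: infinite_finite_induct) (simp_all add: bsign_add del: add_bit_eq_xor)

lemma finite_carrier_bitvec [simp]: "finite (carrier_vec n :: bitvec set)"
proof -
  have "x \<in> Matrix.vec n ` (PiE {..<n} (\<lambda>_. {0, 1}))" if "x \<in> carrier_vec n" for x :: bitvec
  proof
    show "x = Matrix.vec n (restrict (vec_index x) {..<n})"
      using that by (intro eq_vecI) simp_all
    show "restrict (vec_index x) {..<n} \<in> PiE {..<n} (\<lambda>_. {0, 1})"
      by auto
  qed
  then have "(carrier_vec n :: bitvec set) \<subseteq> Matrix.vec n ` (PiE {..<n} (\<lambda>_. {0, 1}))"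
    by blast
  then show ?thesis
    by (rule finite_subset) (intro finite_imageI finite_PiE; simp)
qed

section \<open>Blocks\<close>

definition concat_blocks :: "nat \<Rightarrow> nat \<Rightarrow> (nat \<Rightarrow> bitvec) \<Rightarrow> bitvec" where
  "concat_blocks n k u = Matrix.vec (k * n) (\<lambda>i. vec_index (u (i div n)) (i mod n))"

lemma concat_blocks_carrier [simp]: "concat_blocks n k u \<in> carrier_vec (k * n)"
  by (simp add: concat_blocks_def)

lemma block_carrier [simp]: "block n x j \<in> carrier_vec n"
  by (simp add: block_def)

lemma block_index_bound:
  fixes i j k n :: nat
  assumes "j < k" "i < n"
  shows "j * n + i < k * n"
proof -
  have "j * n + i < Suc j * n"
    using assms by simp
  also have "\<dots> \<le> k * n"
    using assms by (intro mult_le_mono1) simp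
  finally show ?thesis .
qed

lemma block_concat_blocks:
  assumes "j < k" "u j \<in> carrier_vec n"
  shows "block n (concat_blocks n k u) j = u j"
  using assms by (intro eq_vecI) (auto simp: block_def concat_blocks_def block_index_bound)

lemma concat_blocks_block:
  assumes "x \<in> carrier_vec (k * n)"
  shows "concat_blocks n k (\<lambda>j. if j < k then block n x j else undefined) = x"
proof (intro eq_vecI)
  fix i assume "i < dim_vec x"
  then have i: "i < k * n"
    using assms by simp
  then have "n > 0"
    by (cases n) auto
  with i have "i div n < k"
    by (simp add: less_mult_imp_div_less)
  with i \<open>n > 0\<close> show "concat_blocks n k (\<lambda>j. if j < k then block n x j else undefined) $ i = x $ i"
    by (simp add: concat_blocks_def block_def)
qed (use assms in \<open>simp add: concat_blocks_def\<close>)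

text \<open>Cutting into blocks is a bijection from the long cube onto \<open>k\<close>-tuples;
  distributivity does the rest. This yields both the total mass of a product distribution and its
  Fourier coefficients.\<close>

lemma sum_prod_blocks:
  fixes F :: "nat \<Rightarrow> bitvec \<Rightarrow> real"
  shows "(\<Sum>x\<in>carrier_vec (k * n). \<Prod>j<k. F j (block n x j)) =
    (\<Prod>j<k. \<Sum>y\<in>carrier_vec n. F j y)"
proof -
  have "(\<Sum>x\<in>carrier_vec (k * n). \<Prod>j<k. F j (block n x j)) =
      (\<Sum>u\<in>PiE {..<k} (\<lambda>_. carrier_vec n). \<Prod>j<k. F j (u j))"
  \<comment> \<open>The value \<open>undefined\<close> from index \<open>k\<close> on makes the
    tuple of blocks extensional, as \<open>PiE\<close> demands.\<close>
  proof (rule sum.reindex_bij_witness[where i = "concat_blocks n k"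
        and j = "\<lambda>x j. if j < k then block n x j else undefined"])
    fix u :: "nat \<Rightarrow> bitvec"
    assume u: "u \<in> PiE {..<k} (\<lambda>_. carrier_vec n)"
    show "(\<lambda>j. if j < k then block n (concat_blocks n k u) j else undefined) = u"
      using u by (auto simp: fun_eq_iff block_concat_blocks PiE_iff extensional_def)
  qed (auto simp: concat_blocks_block split: if_splits)
  then show ?thesis
    by (simp add: prod_sum_PiE)
qed

lemma scalar_prod_blocks:
  assumes "a \<in> carrier_vec (k * n)" "x \<in> carrier_vec (k * n)"
  shows "a \<bullet> x = (\<Sum>j<k. block n a j \<bullet> block n x j)"
proof -
  have "a \<bullet> x = (\<Sum>i<k * n. a $ i * x $ i)"
    using assms by (simp add: scalar_prod_def lessThan_atLeast0)
  also have "\<dots> = (\<Sum>j<k. \<Sum>i\<in>{j * n..<j * n + n}. a $ i * x $ i)"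
    by (simp only: sum.nat_group)
  also have "\<dots> = (\<Sum>j<k. \<Sum>i<n. a $ (j * n + i) * x $ (j * n + i))"
  proof (rule sum.cong[OF refl])
    fix j
    show "(\<Sum>i\<in>{j * n..<j * n + n}. a $ i * x $ i) = (\<Sum>i<n. a $ (j * n + i) * x $ (j * n + i))"
      by (rule sum.reindex_bij_witness[where i = "\<lambda>i. j * n + i" and j = "\<lambda>i. i - j * n"]) auto
  qed
  also have "\<dots> = (\<Sum>j<k. block n a j \<bullet> block n x j)"
    by (simp add: scalar_prod_def block_def lessThan_atLeast0)
  finally show ?thesis .
qed

section \<open>Correlation with parity decision trees\<close>

text \<open>A query splits the weight into two parts that both still obey the Fourier bound, so each
  level costs at most a factor 2. The induction therefore needs arbitrary real weights
  \<open>w\<close>.\<close>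

lemma pdt_correlation_bound:
  fixes w :: "bitvec \<Rightarrow> real" and s :: "'b \<Rightarrow> real"
  assumes "pdt_on N B T" "pdt_depth T \<le> d"
    and "\<And>a. a \<in> carrier_vec N \<Longrightarrow> \<bar>\<Sum>x\<in>carrier_vec N. w x * bsign (a \<bullet> x)\<bar> \<le> M"
    and s: "\<And>b. \<bar>s b\<bar> \<le> 1"
  shows "\<bar>\<Sum>x\<in>carrier_vec N. w x * s (pdt_eval T x)\<bar> \<le> 2 ^ d * M"
  using assms(1-3)
proof (induction T arbitrary: d w)
  case (Leaf b)
  \<comment> \<open>A leaf sees only the total weight, which is the Fourier coefficient at the zero
    vector. This also gives \<open>M \<ge> 0\<close>.\<close>
  have M: "\<bar>\<Sum>x\<in>carrier_vec N. w x\<bar> \<le> M"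
    using Leaf(3)[of "0\<^sub>v N"] by simp
  have "\<bar>\<Sum>x\<in>carrier_vec N. w x * s (pdt_eval (Leaf b) x)\<bar> = \<bar>\<Sum>x\<in>carrier_vec N. w x\<bar> * \<bar>s b\<bar>"
    by (simp flip: sum_distrib_right add: abs_mult)
  also have "\<dots> \<le> M * 1"
    using M s by (intro mult_mono) auto
  also have "\<dots> \<le> 2 ^ d * M"
    using M mult_right_mono[of 1 "2 ^ d" M] by simp
  finally show ?case .
next
  case (Query a T0 T1)
  from Query.prems(2) obtain d' where d: "d = Suc d'"
    by (cases d) auto
  have a: "a \<in> carrier_vec N" and sub: "pdt_on N B T0" "pdt_on N B T1"
    and dep: "pdt_depth T0 \<le> d'" "pdt_depth T1 \<le> d'"
    using Query.prems d by auto
  \<comment> \<open>Restricting \<open>w\<close> to one outcome averages its Fourier coefficients at \<open>b\<close> and \<open>a + b\<close>,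
    up to sign, so the bound \<open>M\<close> persists.\<close>
  define w' where "w' = (\<lambda>e x. w x * ((1 + e * bsign (a \<bullet> x)) / 2))"
  have coeff: "\<bar>\<Sum>x\<in>carrier_vec N. w' e x * bsign (b \<bullet> x)\<bar> \<le> M"
    if b: "b \<in> carrier_vec N" and e: "\<bar>e\<bar> = 1" for b and e :: real
  proof -
    let ?A = "\<Sum>x\<in>carrier_vec N. w x * bsign (b \<bullet> x)"
    let ?B = "\<Sum>x\<in>carrier_vec N. w x * bsign ((a + b) \<bullet> x)"
    have "(\<Sum>x\<in>carrier_vec N. w' e x * bsign (b \<bullet> x)) =
        (\<Sum>x\<in>carrier_vec N. w x * bsign (b \<bullet> x) / 2 + e * (w x * bsign ((a + b) \<bullet> x)) / 2)"
      using a b by (intro sum.cong refl)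
        (simp add: w'_def add_scalar_prod_distrib[of _ N] bsign_add field_simps
          del: add_bit_eq_xor)
    also have "\<dots> = ?A / 2 + e * ?B / 2"
      by (simp only: sum.distrib sum_divide_distrib[symmetric] sum_distrib_left[symmetric])
    finally have eq: "(\<Sum>x\<in>carrier_vec N. w' e x * bsign (b \<bullet> x)) = ?A / 2 + e * ?B / 2" .
    have "\<bar>?A\<bar> \<le> M" "\<bar>?B\<bar> \<le> M"
      using a b Query.prems(3) by auto
    moreover have "\<bar>e * ?B\<bar> = \<bar>?B\<bar>"
      using e by (simp add: abs_mult)
    ultimately show ?thesis
      unfolding eq by linarith
  qed
  \<comment> \<open>The factor in \<open>w'\<close> is the indicator of one answer:
    \<open>w' 1\<close> keeps the inputs sent to \<open>T0\<close>, and \<open>w' (- 1)\<close>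
    those sent to \<open>T1\<close>.\<close>
  have "(\<Sum>x\<in>carrier_vec N. w x * s (pdt_eval (Query a T0 T1) x)) =
      (\<Sum>x\<in>carrier_vec N. w' 1 x * s (pdt_eval T0 x) + w' (- 1) x * s (pdt_eval T1 x))"
    by (intro sum.cong refl) (simp add: w'_def bsign_def)
  also have "\<dots> = (\<Sum>x\<in>carrier_vec N. w' 1 x * s (pdt_eval T0 x)) +
      (\<Sum>x\<in>carrier_vec N. w' (- 1) x * s (pdt_eval T1 x))"
    by (rule sum.distrib)
  finally have "\<bar>\<Sum>x\<in>carrier_vec N. w x * s (pdt_eval (Query a T0 T1) x)\<bar> \<le>
      \<bar>\<Sum>x\<in>carrier_vec N. w' 1 x * s (pdt_eval T0 x)\<bar> +
      \<bar>\<Sum>x\<in>carrier_vec N. w' (- 1) x * s (pdt_eval T1 x)\<bar>"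
    using abs_triangle_ineq by metis
  also have "\<dots> \<le> 2 ^ d' * M + 2 ^ d' * M"
    by (intro add_mono Query.IH sub dep coeff) auto
  finally show ?case
    unfolding d power_Suc by linarith
qed

text \<open>A leaf has one output, and a query at most adds the two counts. Finiteness is carried
  along because \<open>card\<close> of an infinite set is 0.\<close>

lemma range_pdt_eval:
  "finite (range (pdt_eval T)) \<and> card (range (pdt_eval T)) \<le> 2 ^ pdt_depth T"
proof (induction T)
  case (Leaf b)
  have "range (pdt_eval (Leaf b)) = {b}"
    by auto
  then show ?case
    by simp
next
  case (Query a T0 T1)
  let ?R = "range (pdt_eval T0) \<union> range (pdt_eval T1)"
  let ?m = "max (pdt_depth T0) (pdt_depth T1)"
  have sub: "range (pdt_eval (Query a T0 T1)) \<subseteq> ?R"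
    by auto
  have fin: "finite ?R"
    using Query.IH by simp
  have "card (range (pdt_eval (Query a T0 T1))) \<le> card ?R"
    by (rule card_mono[OF fin sub])
  also have "\<dots> \<le> card (range (pdt_eval T0)) + card (range (pdt_eval T1))"
    by (rule card_Un_le)
  also have "\<dots> \<le> 2 ^ ?m + 2 ^ ?m"
  proof (intro add_mono)
    show "card (range (pdt_eval T0)) \<le> 2 ^ ?m"
      using Query.IH(1) power_increasing[of "pdt_depth T0" ?m "2::nat"] by linarith
    show "card (range (pdt_eval T1)) \<le> 2 ^ ?m"
      using Query.IH(2) power_increasing[of "pdt_depth T1" ?m "2::nat"] by linarith
  qed
  finally show ?case
    using finite_subset[OF sub fin] by simp
qed

section \<open>Randomised parity decision trees\<close>

text \<open>The easy half of Yao's principle: exchange sum and expectation, then some tree in the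
  support does no worse than the mean. Inputs are indexed through \<open>\<xi>\<close> so that a
  distribution on output patterns can be used directly.\<close>

lemma rpdt_computes_imp_average:
  fixes p :: "'i \<Rightarrow> real"
  assumes R: "rpdt_computes N m g d R"
    and "finite I" "\<And>i. i \<in> I \<Longrightarrow> p i \<ge> 0" "sum p I = 1" "\<And>i. i \<in> I \<Longrightarrow> \<xi> i \<in> carrier_vec N"
  obtains T where "pdt_on N (carrier_vec m) T" "pdt_depth T \<le> d"
    "(\<Sum>i\<in>I. p i * of_bool (pdt_eval T (\<xi> i) \<noteq> g (\<xi> i))) \<le> 1 / 3"
proof -
  let ?err = "\<lambda>T. \<Sum>i\<in>I. p i * indicator {T. pdt_eval T (\<xi> i) \<noteq> g (\<xi> i)} T"
  have int: "integrable (measure_pmf R) (\<lambda>T. p i * indicator {T. pdt_eval T (\<xi> i) \<noteq> g (\<xi> i)} T)" for i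
    by (intro integrable_mult_right measure_pmf.integrable_const_bound[where B = 1]) (auto simp: indicator_def)
  have "measure_pmf.expectation R ?err =
      (\<Sum>i\<in>I. p i * measure_pmf.prob R {T. pdt_eval T (\<xi> i) \<noteq> g (\<xi> i)})"
    by (subst Bochner_Integration.integral_sum) (use int in auto)
  also have "\<dots> \<le> (\<Sum>i\<in>I. p i * (1 / 3))"
    using assms unfolding rpdt_computes_def by (intro sum_mono mult_left_mono) auto
  also have "\<dots> = 1 / 3"
    using assms by (simp flip: sum_divide_distrib)
  finally have le: "measure_pmf.expectation R ?err \<le> 1 / 3" .
  have "\<exists>T\<in>set_pmf R. ?err T \<le> 1 / 3"
  proof (rule ccontr)
    assume "\<not> ?thesis"
    then have "AE T in measure_pmf R. 1 / 3 < ?err T"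
      by (auto simp: AE_measure_pmf_iff not_le)
    then have "1 / 3 < measure_pmf.expectation R ?err"
      by (intro measure_pmf.expectation_greater Bochner_Integration.integrable_sum int)
    with le show False
      by simp
  qed
  then obtain T where T: "T \<in> set_pmf R" "?err T \<le> 1 / 3"
    by blast
  have "?err T = (\<Sum>i\<in>I. p i * of_bool (pdt_eval T (\<xi> i) \<noteq> g (\<xi> i)))"
    by (simp only: indicator_def mem_Collect_eq)
  with T(2) have "(\<Sum>i\<in>I. p i * of_bool (pdt_eval T (\<xi> i) \<noteq> g (\<xi> i))) \<le> 1 / 3"
    by (simp only:)
  moreover have "pdt_on N (carrier_vec m) T" "pdt_depth T \<le> d"
    using R T(1) unfolding rpdt_computes_def by blast+
  ultimately show ?thesis
    using that by blast
qed

text \<open>Querying all coordinates in turn determines the input. This serves to show that the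
  minimum defining \<open>R_pdt\<close> is over a nonempty set.\<close>

lemma exists_pdt_computing:
  assumes "\<And>x. x \<in> carrier_vec N \<Longrightarrow> g x \<in> B"
  shows "\<exists>T. pdt_on N B T \<and> (\<forall>x\<in>carrier_vec N. pdt_eval T x = g x)"
proof -
  \<comment> \<open>Induction on the number \<open>m\<close> of coordinates still unknown; those
    from \<open>m\<close> on have been read and agree with \<open>h\<close>.\<close>
  have "\<exists>T. pdt_on N B T \<and>
      (\<forall>x\<in>carrier_vec N. (\<forall>i. m \<le> i \<longrightarrow> i < N \<longrightarrow> x $ i = h i) \<longrightarrow> pdt_eval T x = g x)"
    if "m \<le> N" for m h
    using that
  proof (induction m arbitrary: h)
    case 0
    show ?case
    proof (intro exI[of _ "Leaf (g (Matrix.vec N h))"] conjI ballI impI)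
      fix x :: bitvec
      assume "x \<in> carrier_vec N" "\<forall>i. 0 \<le> i \<longrightarrow> i < N \<longrightarrow> x $ i = h i"
      then have "x = Matrix.vec N h"
        by (intro eq_vecI) simp_all
      then show "pdt_eval (Leaf (g (Matrix.vec N h))) x = g x"
        by simp
    qed (use assms in simp)
  next
    case (Suc m)
    from Suc obtain T0 where T0: "pdt_on N B T0" "\<And>x. x \<in> carrier_vec N \<Longrightarrow>
        \<forall>i. m \<le> i \<longrightarrow> i < N \<longrightarrow> x $ i = (h(m := 0)) i \<Longrightarrow> pdt_eval T0 x = g x"
      by (metis Suc_leD)
    from Suc obtain T1 where T1: "pdt_on N B T1" "\<And>x. x \<in> carrier_vec N \<Longrightarrow>
        \<forall>i. m \<le> i \<longrightarrow> i < N \<longrightarrow> x $ i = (h(m := 1)) i \<Longrightarrow> pdt_eval T1 x = g x"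
      by (metis Suc_leD)
    have "pdt_eval (Query (unit_vec N m) T0 T1) x = g x"
      if x: "x \<in> carrier_vec N" "\<forall>i. Suc m \<le> i \<longrightarrow> i < N \<longrightarrow> x $ i = h i" for x
    proof -
      have "unit_vec N m \<bullet> x = x $ m"
        using x Suc.prems by (simp add: scalar_prod_left_unit)
      then show ?thesis
        using T0(2)[of x] T1(2)[of x] x by (cases "x $ m") (auto simp: Suc_le_eq)
    qed
    then show ?case
      using T0(1) T1(1) by (intro exI[of _ "Query (unit_vec N m) T0 T1"]) auto
  qed
  from this[of N] show ?thesis
    by auto
qed

lemma R_pdt_attained:
  assumes "\<And>x. x \<in> carrier_vec N \<Longrightarrow> g x \<in> carrier_vec m"
  obtains R where "rpdt_computes N m g (R_pdt N m g) R"
proof -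
  obtain T where "pdt_on N (carrier_vec m) T" "\<forall>x\<in>carrier_vec N. pdt_eval T x = g x"
    using exists_pdt_computing[of N g "carrier_vec m"] assms by blast
  then have "rpdt_computes N m g (pdt_depth T) (return_pmf T)"
    by (auto simp: rpdt_computes_def)
  then have "\<exists>d R. rpdt_computes N m g d R"
    by blast
  then have "\<exists>R. rpdt_computes N m g (R_pdt N m g) R"
    unfolding R_pdt_def by (rule LeastI_ex)
  with that show ?thesis
    by blast
qed

section \<open>Discrepancy and Fourier coefficients\<close>

lemma affine_subspace_hyperplane:
  assumes a: "a \<in> carrier_vec n" and v: "v \<in> carrier_vec n" "a \<bullet> v = c"
  shows "affine_subspace n {x \<in> carrier_vec n. a \<bullet> x = c}"
proof -
  let ?W = "{w \<in> carrier_vec n. a \<bullet> w = 0}"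
  interpret vectorspace class_ring "module_vec TYPE(bit) n"
    by (rule vec_vs)
  have "VectorSpace.subspace class_ring ?W (module_vec TYPE(bit) n)"
    using a by (unfold_locales)
      (auto simp: module_vec_simps scalar_prod_add_distrib[of _ n])
  moreover have "{x \<in> carrier_vec n. a \<bullet> x = c} = (\<lambda>w. v + w) ` ?W"
  proof (intro equalityI subsetI)
    fix x assume x: "x \<in> {x \<in> carrier_vec n. a \<bullet> x = c}"
    show "x \<in> (\<lambda>w. v + w) ` ?W"
    proof
      \<comment> \<open>In characteristic 2 the vector \<open>x + v\<close> serves as the difference
        of \<open>x\<close> and \<open>v\<close>.\<close>
      have "b = b' + (b + b')" for b b' :: bit
        by (cases b; cases b') simp_all
      then show "x = v + (x + v)"
        using x v(1) by (intro eq_vecI) simp_all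
      show "x + v \<in> ?W"
        using x v a by (simp add: scalar_prod_add_distrib[of _ n])
    qed
  qed (use a v in \<open>auto simp: scalar_prod_add_distrib[of _ n]\<close>)
  ultimately show ?thesis
    unfolding affine_subspace_def using v by blast
qed

lemma affine_subspace_subset:
  assumes "affine_subspace n S"
  shows "S \<subseteq> carrier_vec n"
proof -
  obtain v W where *: "v \<in> carrier_vec n"
      "VectorSpace.subspace class_ring W (module_vec TYPE(bit) n)" "S = (\<lambda>w. v + w) ` W"
    using assms unfolding affine_subspace_def by blast
  have "W \<subseteq> carrier (module_vec TYPE(bit) n)"
    using *(2) by (simp add: VectorSpace.subspace_def submodule_def)
  then show ?thesis
    using * by (auto simp: module_vec_simps)
qed

lemma bias_le_disc_wrt:
  assumes "affine_subspace n S"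
  shows "bias f \<mu> S \<le> 2 powr - disc_wrt n f \<mu>"
proof -
  let ?X = "{bias f \<mu> S |S. affine_subspace n S}"
  have "?X \<subseteq> bias f \<mu> ` Pow (carrier_vec n)"
    using affine_subspace_subset by blast
  then have "finite ?X"
    by (rule finite_subset) simp
  then have "bias f \<mu> S \<le> Max ?X"
    using assms by (intro Max_ge) auto
  also have "\<dots> \<le> 2 powr - disc_wrt n f \<mu>"
  \<comment> \<open>\<open>powr\<close> undoes \<open>log\<close> only at positive arguments;
    otherwise the bound holds because its right side is positive.\<close>
  proof (cases "Max ?X > 0")
    case False
    then have "Max ?X \<le> 0"
      by simp
    then show ?thesis
      by (rule order_trans) simp
  qed (simp add: disc_wrt_def)
  finally show ?thesis .
qed

text \<open>Includes the degenerate case \<open>a = 0\<close>, \<open>c = 1\<close>: the empty set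
  is not an affine subspace, but its bias is 0.\<close>

lemma bias_hyperplane_le_disc_wrt:
  assumes "a \<in> carrier_vec n"
  shows "bias f \<mu> {x \<in> carrier_vec n. a \<bullet> x = c} \<le> 2 powr - disc_wrt n f \<mu>"
proof (cases "\<exists>v\<in>carrier_vec n. a \<bullet> v = c")
  case True
  then obtain v where "v \<in> carrier_vec n" "a \<bullet> v = c"
    by blast
  then show ?thesis
    by (intro bias_le_disc_wrt affine_subspace_hyperplane[OF assms])
next
  case False
  then have "{x \<in> carrier_vec n. a \<bullet> x = c} = {}"
    by blast
  then show ?thesis
    by (simp only: bias_def) simp
qed

lemma bias_alt: "bias f \<mu> S = \<bar>\<Sum>x\<in>S. bsign (f x) * pmf \<mu> x\<bar>"
  by (simp add: bias_def bsign_def)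

lemma fourier_coeff_le_disc_wrt:
  assumes "a \<in> carrier_vec n"
  shows "\<bar>\<Sum>y\<in>carrier_vec n. bsign (f y) * pmf \<mu> y * bsign (a \<bullet> y)\<bar> \<le> 2 * 2 powr - disc_wrt n f \<mu>"
proof -
  let ?F = "\<lambda>y. bsign (f y) * pmf \<mu> y"
  let ?S = "\<lambda>c. {y \<in> carrier_vec n. a \<bullet> y = c}"
  have "(\<Sum>y\<in>carrier_vec n. ?F y * bsign (a \<bullet> y)) = (\<Sum>y\<in>?S 0 \<union> ?S 1. ?F y * bsign (a \<bullet> y))"
    by (rule sum.cong) auto
  also have "\<dots> =
      (\<Sum>y\<in>?S 0. ?F y * bsign (a \<bullet> y)) + (\<Sum>y\<in>?S 1. ?F y * bsign (a \<bullet> y))"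
    by (rule sum.union_disjoint) auto
  also have "\<dots> = (\<Sum>y\<in>?S 0. ?F y) - (\<Sum>y\<in>?S 1. ?F y)"
    by (simp add: sum_negf)
  finally show ?thesis
    using bias_hyperplane_le_disc_wrt[OF assms, of f \<mu> 0] bias_hyperplane_le_disc_wrt[OF assms, of f \<mu> 1]
    unfolding bias_alt by linarith
qed

lemma sum_pmf_cube:
  fixes \<mu> :: "bitvec pmf"
  assumes "set_pmf \<mu> \<subseteq> carrier_vec n"
  shows "(\<Sum>y\<in>carrier_vec n. pmf \<mu> y) = 1"
  using assms by (intro sum_pmf_eq_1) simp_all

lemma disc_wrt_constant_le_zero:
  assumes "set_pmf \<mu> \<subseteq> carrier_vec n" "\<And>x. x \<in> carrier_vec n \<Longrightarrow> f x = b"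
  shows "disc_wrt n f \<mu> \<le> 0"
proof -
  \<comment> \<open>The whole cube is a degenerate hyperplane, and a constant function has bias 1 on
    it.\<close>
  have "{x \<in> carrier_vec n. 0\<^sub>v n \<bullet> x = (0::bit)} = carrier_vec n"
    by auto
  then have "bias f \<mu> (carrier_vec n) \<le> 2 powr - disc_wrt n f \<mu>"
    using bias_hyperplane_le_disc_wrt[of "0\<^sub>v n" n f \<mu> 0] by simp
  moreover have "bias f \<mu> (carrier_vec n) = \<bar>bsign b * (\<Sum>x\<in>carrier_vec n. pmf \<mu> x)\<bar>"
    by (simp add: bias_alt assms sum_distrib_left)
  ultimately have "1 \<le> 2 powr - disc_wrt n f \<mu>"
    using sum_pmf_cube[OF assms(1)] by simp
  then show ?thesis
    using powr_less_one[of 2 "- disc_wrt n f \<mu>"] by force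
qed

section \<open>Two lower bounds\<close>

lemma direct_sum_fun_carrier [simp]: "direct_sum_fun n k f x \<in> carrier_vec k"
  by (simp add: direct_sum_fun_def)

text \<open>Choosing one preimage per bit makes the output pattern uniform on \<open>k\<close> bits.
  Some tree is right on two thirds of the patterns, and each of these is a different output of the
  tree.\<close>

lemma rpdt_depth_ge_copies:
  assumes R: "rpdt_computes (k * n) k (direct_sum_fun n k f) d R"
    and z: "\<And>b. z b \<in> carrier_vec n" "\<And>b. f (z b) = b"
  shows "k \<le> d"
proof -
  let ?I = "PiE {..<k} (\<lambda>_. UNIV :: bit set)"
  let ?\<xi> = "\<lambda>y. concat_blocks n k (\<lambda>j. z (y j))"
  have UNIV_bit: "(UNIV :: bit set) = {0, 1}"
    by auto
  have fin: "finite ?I"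
    by (intro finite_PiE) (auto simp: UNIV_bit)
  have card: "card ?I = 2 ^ k"
    by (simp add: card_PiE UNIV_bit numeral_2_eq_2)
  have g: "direct_sum_fun n k f (?\<xi> y) = Matrix.vec k y" for y
    by (intro eq_vecI) (auto simp: direct_sum_fun_def block_concat_blocks z)
  obtain T where T: "pdt_depth T \<le> d"
    "(\<Sum>y\<in>?I. 1 / 2 ^ k * of_bool (pdt_eval T (?\<xi> y) \<noteq> direct_sum_fun n k f (?\<xi> y))) \<le> (1 / 3 :: real)"
    by (rule rpdt_computes_imp_average[OF R fin, of "\<lambda>_. 1 / 2 ^ k" ?\<xi>]) (simp_all add: card)
  define G where "G = {y \<in> ?I. pdt_eval T (?\<xi> y) = Matrix.vec k y}"
  have "(\<Sum>y\<in>?I. 1 / 2 ^ k * of_bool (pdt_eval T (?\<xi> y) \<noteq> direct_sum_fun n k f (?\<xi> y))) =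
      (\<Sum>y\<in>?I. 1 / 2 ^ k - 1 / 2 ^ k * of_bool (y \<in> G) :: real)"
    by (intro sum.cong) (auto simp: g G_def)
  also have "\<dots> = 1 - real (card G) / 2 ^ k"
  proof -
    have "(\<Sum>y\<in>?I. 1 / 2 ^ k * of_bool (y \<in> G) :: real) = real (card (?I \<inter> G)) / 2 ^ k"
      using fin by (simp flip: sum_distrib_left sum_divide_distrib add: of_bool_def sum.If_cases)
    moreover have "?I \<inter> G = G"
      by (auto simp: G_def)
    ultimately show ?thesis
      by (simp add: sum_subtractf card)
  qed
  finally have "1 - real (card G) / 2 ^ k \<le> 1 / 3"
    using T(2) by (simp only:)
  then have "real (card G) \<ge> 2 / 3 * 2 ^ k"
    by (simp add: field_simps)
  moreover have "card G \<le> 2 ^ d"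
  proof -
    have "inj_on (Matrix.vec k) G"
    proof (rule inj_onI)
      fix y y' assume y: "y \<in> G" "y' \<in> G" "Matrix.vec k y = Matrix.vec k y'"
      have "y j = y' j" if "j < k" for j
        using arg_cong[OF y(3), of "\<lambda>v. v $ j"] that by (simp only: index_vec)
      then show "y = y'"
        using y by (intro PiE_ext[of y "{..<k}" "\<lambda>_. UNIV"]) (auto simp: G_def)
    qed
    moreover have "Matrix.vec k ` G \<subseteq> range (pdt_eval T)"
    proof
      fix b assume "b \<in> Matrix.vec k ` G"
      then obtain y where y: "y \<in> G" "b = Matrix.vec k y"
        by blast
      then have "b = pdt_eval T (?\<xi> y)"
        by (simp add: G_def)
      then show "b \<in> range (pdt_eval T)"
        by (rule range_eqI)
    qed
    ultimately have "card G \<le> card (range (pdt_eval T))"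
      using range_pdt_eval[of T] by (intro card_inj_on_le) auto
    also have "\<dots> \<le> 2 ^ pdt_depth T"
      using range_pdt_eval by blast
    also have "\<dots> \<le> 2 ^ d"
      using T by simp
    finally show ?thesis .
  qed
  then have "real (card G) \<le> 2 ^ d"
    by simp
  ultimately have "2 / 3 * 2 ^ k \<le> (2 ^ d :: real)"
    by linarith
  \<comment> \<open>The loss 3/2 is below 2, so integrality of the exponents absorbs it.\<close>
  then have "(2::real) ^ k < 2 ^ Suc d"
    using zero_less_power[of "2::real" d] unfolding power_Suc by linarith
  then show ?thesis
    by (simp only: power_strict_increasing_iff)
qed

lemma rpdt_depth_xor_bound:
  assumes R: "rpdt_computes (k * n) k (direct_sum_fun n k f) d R"
    and \<mu>: "set_pmf \<mu> \<subseteq> carrier_vec n"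
  shows "1 / 3 \<le> 2 ^ d * (2 * 2 powr - disc_wrt n f \<mu>) ^ k"
proof -
  let ?C = "carrier_vec (k * n)" and ?g = "direct_sum_fun n k f"
  define p where "p x = (\<Prod>j<k. pmf \<mu> (block n x j))" for x
  define s where "s y = (\<Prod>j<k. bsign (y $ j))" for y :: bitvec
  have p_nonneg: "p x \<ge> 0" for x
    by (auto simp: p_def intro: prod_nonneg)
  have p_sum: "sum p ?C = 1"
    unfolding p_def using sum_prod_blocks[of "\<lambda>_. pmf \<mu>" n k] sum_pmf_cube[OF \<mu>] by simp
  have s_sq: "s y * s y = 1" for y
    by (simp add: s_def flip: prod.distrib)
  have s_abs: "\<bar>s y\<bar> = 1" for y
    by (simp add: s_def abs_prod)
  obtain T where T: "pdt_on (k * n) (carrier_vec k) T" "pdt_depth T \<le> d"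
    "(\<Sum>x\<in>?C. p x * of_bool (pdt_eval T x \<noteq> ?g x)) \<le> 1 / 3"
    using rpdt_computes_imp_average[OF R, of ?C p "\<lambda>x. x"] p_nonneg p_sum by auto
  have coeff: "\<bar>\<Sum>x\<in>?C. (p x * s (?g x)) * bsign (a \<bullet> x)\<bar> \<le> (2 * 2 powr - disc_wrt n f \<mu>) ^ k"
    if a: "a \<in> ?C" for a
  proof -
    \<comment> \<open>Distribution, parity sign and character all factor over the blocks, hence so
      does the Fourier coefficient.\<close>
    have "(\<Sum>x\<in>?C. (p x * s (?g x)) * bsign (a \<bullet> x)) =
        (\<Sum>x\<in>?C. \<Prod>j<k. bsign (f (block n x j)) * pmf \<mu> (block n x j) * bsign (block n a j \<bullet> block n x j))"
      using a by (intro sum.cong refl)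
        (simp add: p_def s_def direct_sum_fun_def scalar_prod_blocks bsign_sum prod.distrib)
    also have "\<dots> = (\<Prod>j<k. \<Sum>y\<in>carrier_vec n. bsign (f y) * pmf \<mu> y * bsign (block n a j \<bullet> y))"
      by (rule sum_prod_blocks)
    finally have "\<bar>\<Sum>x\<in>?C. (p x * s (?g x)) * bsign (a \<bullet> x)\<bar> =
        (\<Prod>j<k. \<bar>\<Sum>y\<in>carrier_vec n. bsign (f y) * pmf \<mu> y * bsign (block n a j \<bullet> y)\<bar>)"
      by (simp add: abs_prod)
    also have "\<dots> \<le> (\<Prod>j<k. 2 * 2 powr - disc_wrt n f \<mu>)"
      by (intro prod_mono conjI abs_ge_zero fourier_coeff_le_disc_wrt) simp
    finally show ?thesis
      by simp
  qed
  have "1 / 3 \<le> (\<Sum>x\<in>?C. p x) - 2 * (\<Sum>x\<in>?C. p x * of_bool (pdt_eval T x \<noteq> ?g x))"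
    using T(3) p_sum by simp
  also have "\<dots> = (\<Sum>x\<in>?C. p x * (1 - 2 * of_bool (pdt_eval T x \<noteq> ?g x)))"
    by (simp add: sum_subtractf sum_distrib_left right_diff_distrib mult.left_commute
        del: sum_mult_of_bool_eq)
  \<comment> \<open>Correct outputs have the correct parity, so the product of signs is 1 there; on
    errors it is at least -1.\<close>
  also have "\<dots> \<le> (\<Sum>x\<in>?C. (p x * s (?g x)) * s (pdt_eval T x))"
  proof (rule sum_mono)
    fix x
    have "1 - 2 * of_bool (pdt_eval T x \<noteq> ?g x) \<le> s (?g x) * s (pdt_eval T x)"
    proof (cases "pdt_eval T x = ?g x")
      case False
      have "\<bar>s (?g x) * s (pdt_eval T x)\<bar> = 1"
        by (simp add: abs_mult s_abs)
      with False show ?thesis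
        by (simp add: abs_if split: if_splits)
    qed (simp add: s_sq)
    then show "p x * (1 - 2 * of_bool (pdt_eval T x \<noteq> ?g x)) \<le> (p x * s (?g x)) * s (pdt_eval T x)"
      using mult_left_mono[OF _ p_nonneg] by (simp add: mult.assoc)
  qed
  also have "\<dots> \<le> 2 ^ d * (2 * 2 powr - disc_wrt n f \<mu>) ^ k"
    using pdt_correlation_bound[OF T(1,2) coeff, of s] s_abs by (simp add: abs_le_iff)
  finally show ?thesis .
qed

section \<open>Combining the two bounds, and passing to the maximal discrepancy\<close>

lemma rpdt_depth_ge_disc_wrt:
  assumes R: "rpdt_computes (k * n) k (direct_sum_fun n k f) d R"
    and \<mu>: "set_pmf \<mu> \<subseteq> carrier_vec n" and k: "k \<ge> 1"
  shows "real k * disc_wrt n f \<mu> \<le> 4 * real d"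
proof (cases "\<forall>b. \<exists>x\<in>carrier_vec n. f x = b")
  case False
  then obtain b where "\<And>x. x \<in> carrier_vec n \<Longrightarrow> f x \<noteq> b"
    by blast
  then have "f x = b + 1" if "x \<in> carrier_vec n" for x
    using that by (cases "f x"; cases b) force+
  then have "disc_wrt n f \<mu> \<le> 0"
    by (rule disc_wrt_constant_le_zero[OF \<mu>])
  then have "real k * disc_wrt n f \<mu> \<le> 0"
    by (simp add: mult_nonneg_nonpos)
  then show ?thesis
    by linarith
next
  case True
  then obtain z where "\<forall>b. z b \<in> carrier_vec n \<and> f (z b) = b"
    by metis
  then have kd: "real k \<le> real d"
    using rpdt_depth_ge_copies[OF R, of z] by simp
  define D where "D = disc_wrt n f \<mu>"
  show ?thesis
  proof (cases "D \<le> 4")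
    case True
    then have "real k * D \<le> real k * 4"
      by (intro mult_left_mono) auto
    then show ?thesis
      using kd by (simp add: D_def)
  next
    case False
    \<comment> \<open>Weakening 1/3 to a power of 2 lets the exponents be compared.\<close>
    have "2 powr - 2 < (1 / 3 :: real)"
      by (simp add: powr_minus)
    also have "\<dots> \<le> 2 ^ d * (2 * 2 powr - D) ^ k"
      using rpdt_depth_xor_bound[OF R \<mu>] by (simp add: D_def)
    also have "(2 * 2 powr - D) = 2 powr (1 - D)"
      by (simp add: powr_diff powr_minus divide_inverse)
    also have "(2 powr (1 - D)) ^ k = 2 powr (real k * (1 - D))"
      by (simp add: powr_powr mult.commute flip: powr_realpow)
    also have "2 ^ d * 2 powr (real k * (1 - D)) = 2 powr (real d + real k * (1 - D))"
      by (simp add: powr_add powr_realpow)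
    finally have "- 2 < real d + real k * (1 - D)"
      by simp
    moreover have "real k * 4 \<le> real k * D"
      using False by (intro mult_left_mono) auto
    \<comment> \<open>The first fact reads \<open>k * D < d + k + 2\<close>. With
      \<open>k \<le> k * D / 4\<close> this gives \<open>3/4 * k * D < d + 2\<close>, and
      \<open>d + 2 \<le> 3 * d\<close> since \<open>d \<ge> k \<ge> 1\<close>.\<close>
    ultimately show ?thesis
      using k kd unfolding D_def[symmetric] by (simp add: algebra_simps)
  qed
qed

theorem theorem1:
  shows "\<exists>c::real. c > 0 \<and>
    (\<forall>(n::nat) (k::nat) (f :: bitvec \<Rightarrow> bit). n \<ge> 1 \<longrightarrow> k \<ge> 1 \<longrightarrow>
       real (R_pdt (k * n) k (direct_sum_fun n k f)) \<ge> c * real k * disc n f)"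
proof (intro exI[of _ "1 / 4"] conjI allI impI)
  fix n k :: nat and f :: "bitvec \<Rightarrow> bit"
  assume k: "k \<ge> 1"
  let ?d = "R_pdt (k * n) k (direct_sum_fun n k f)"
  obtain R where R: "rpdt_computes (k * n) k (direct_sum_fun n k f) ?d R"
    by (rule R_pdt_attained[of "k * n" "direct_sum_fun n k f" k]) auto
  \<comment> \<open>A point mass shows that the supremum is over a nonempty family, which
    \<open>cSUP_least\<close> requires.\<close>
  have "return_pmf (0\<^sub>v n :: bitvec) \<in> {\<mu>. set_pmf \<mu> \<subseteq> carrier_vec n}"
    by simp
  then have "disc n f \<le> 4 * real ?d / real k"
    unfolding disc_def
  proof (intro cSUP_least)
    fix \<mu> :: "bitvec pmf"
    assume "\<mu> \<in> {\<mu>. set_pmf \<mu> \<subseteq> carrier_vec n}"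
    then show "disc_wrt n f \<mu> \<le> 4 * real ?d / real k"
      using rpdt_depth_ge_disc_wrt[OF R _ k] k by (simp add: field_simps)
  qed blast
  then show "1 / 4 * real k * disc n f \<le> real ?d"
    using k by (simp add: field_simps)
qed simp

end
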